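(* For every $\alpha\ge 1$, there exists an $\alpha$-aided $O(d^2\log(\alpha k))$-competitive algorithm for the monotone matroid secretary problem, where $d$ is the supermodular degree of $f$ and $k$ is the rank of the matroid.
   Context: The monotone matroid secretary problem: an instance consists of a finite ground set $\mathcal{N}$ of size $n$, a non-negative monotone set function $f:2^{\mathcal N}\to\mathbb{R}_{\ge 0}$, and a matroid $M=(\mathcal N,\mathcal I)$ of rank $k$. The elements of $\mathcal N$ are revealed one at a time in a uniformly random order; upon the arrival of each element the algorithm must decide immediately and irrevocably whether to include it in its output, and the output must be an independent set of $M$. For $u\in\mathcal N$ and $S\subseteq \mathcal N$ write $f(u\mid S)=f(S\cup\{u\})-f(S)$. The supermodular dependency set of $u$ is $\mathcal D^+(u)=\{v\in\mathcal N:\exists S\subseteq\mathcal N,\ f(u\mid S\cup\{v\})>f(u\mid S)\}$, and the supermodular degree of $f$ is $d=\max_{u\in\mathcal N}|\mathcal D^+(u)|$. The algorithm knows $n$ and $d$ and has access to: an independence oracle for $M$; an online marginal oracle (given an already revealed element $u$ and any $S\subseteq\mathcal N$, returns $f(u\mid S)$); and an online supermodular oracle (given an already revealed element $u$, returns $\mathcal D^+(u)$). An algorithm is $c$-competitive if for every instance $f(OPT)\le c\cdot\mathbb E[f(ALG)]$, where $OPT$ is an independent set maximizing $f$, $ALG$ is the algorithm's output, and the expectation is over the random arrival order and the algorithm's randomness. A value $\mathsf{opt}_\alpha$ is an $\alpha$-estimation of $OPT$ if $f(OPT)/\alpha\le \mathsf{opt}_\alpha\le f(OPT)$; an algorithm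 is $\alpha$-aided if it receives an $\alpha$-estimation of the optimum as part of its input (its competitive ratio guarantee must hold for any such given estimation). *)

theory Defs
  imports "HOL-Probability.Probability" "HOL-Combinatorics.Multiset_Permutations"
begin

locale matroid =
  fixes N :: "'a set" and indep :: "'a set \<Rightarrow> bool"
  assumes finite_ground: "finite N"
    and indep_subset: "indep X \<Longrightarrow> X \<subseteq> N"
    and indep_empty: "indep {}"
    and indep_hereditary: "indep Y \<Longrightarrow> X \<subseteq> Y \<Longrightarrow> indep X"
    and indep_augment: "indep X \<Longrightarrow> indep Y \<Longrightarrow> card X < card Y \<Longrightarrow> \<exists>y\<in>Y - X. indep (insert y X)"

definition matroid_rank :: "('a set \<Rightarrow> bool) \<Rightarrow> nat" where
  "matroid_rank indep = Max (card ` {X. indep X})"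

definition marginal :: "('a set \<Rightarrow> real) \<Rightarrow> 'a \<Rightarrow> 'a set \<Rightarrow> real" where
  "marginal f u S = f (S \<union> {u}) - f S"

definition supermodular_deps :: "'a set \<Rightarrow> ('a set \<Rightarrow> real) \<Rightarrow> 'a \<Rightarrow> 'a set" where
  "supermodular_deps N f u = {v \<in> N. \<exists>S\<subseteq>N. marginal f u (S \<union> {v}) > marginal f u S}"

text \<open>The inserted \<open>0\<close> only matters for the empty ground set.\<close>

definition supermodular_degree :: "'a set \<Rightarrow> ('a set \<Rightarrow> real) \<Rightarrow> nat" where
  "supermodular_degree N f = Max (insert 0 ((\<lambda>u. card (supermodular_deps N f u)) ` N))"

text \<open>The values of \<open>f\<close> outside the subsets of \<open>N\<close> are irrelevant and unconstrained.\<close>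

locale matroid_secretary_instance = matroid N indep
  for N :: "'a set" and indep :: "'a set \<Rightarrow> bool" +
  fixes f :: "'a set \<Rightarrow> real"
  assumes nonneg: "S \<subseteq> N \<Longrightarrow> 0 \<le> f S"
    and monotone: "S \<subseteq> T \<Longrightarrow> T \<subseteq> N \<Longrightarrow> f S \<le> f T"

definition opt_value :: "('a set \<Rightarrow> bool) \<Rightarrow> ('a set \<Rightarrow> real) \<Rightarrow> real" where
  "opt_value indep f = Max (f ` {X. indep X})"

definition is_estimation :: "real \<Rightarrow> ('a set \<Rightarrow> bool) \<Rightarrow> ('a set \<Rightarrow> real) \<Rightarrow> real \<Rightarrow> bool" where
  "is_estimation \<alpha> indep f est \<longleftrightarrow> opt_value indep f / \<alpha> \<le> est \<and> est \<le> opt_value indep f"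

text \<open>The online oracles, when the elements of \<open>R\<close> have been revealed.  A query about an
  element that has not been revealed, or about a set that is not a subset of \<open>N\<close>, gets a fixed
  answer carrying no information on \<open>f\<close>.\<close>

definition online_marginal ::
  "'a set \<Rightarrow> ('a set \<Rightarrow> real) \<Rightarrow> 'a set \<Rightarrow> 'a \<Rightarrow> 'a set \<Rightarrow> real" where
  "online_marginal N f R u S = (if u \<in> R \<and> S \<subseteq> N then marginal f u S else 0)"

definition online_deps :: "'a set \<Rightarrow> ('a set \<Rightarrow> real) \<Rightarrow> 'a set \<Rightarrow> 'a \<Rightarrow> 'a set" where
  "online_deps N f R u = (if u \<in> R then supermodular_deps N f u else {})"

text \<open>A deterministic online policy decides on the element that has just arrived, given the list of
  all elements revealed so far (in order of arrival, the current one last), the online marginal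
  oracle and the online supermodular oracle.  Earlier decisions need not be passed on: they are
  determined by prefixes of the list and restrictions of the oracles.\<close>

type_synonym 'a policy = "'a list \<Rightarrow> ('a \<Rightarrow> 'a set \<Rightarrow> real) \<Rightarrow> ('a \<Rightarrow> 'a set) \<Rightarrow> bool"

text \<open>A randomised algorithm is a distribution over deterministic policies.  It may depend on what
  is available before the first arrival: the number of elements \<open>n\<close>, the supermodular degree \<open>d\<close>,
  the estimation of the optimum, and the independence oracle.\<close>

type_synonym 'a aided_algorithm = "nat \<Rightarrow> nat \<Rightarrow> real \<Rightarrow> ('a set \<Rightarrow> bool) \<Rightarrow> 'a policy pmf"

definition policy_output :: "'a set \<Rightarrow> ('a set \<Rightarrow> real) \<Rightarrow> 'a policy \<Rightarrow> 'a list \<Rightarrow> 'a set" where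
  "policy_output N f p \<sigma> =
    {\<sigma> ! i | i. i < length \<sigma> \<and>
       (let seen = take (Suc i) \<sigma>
        in p seen (online_marginal N f (set seen)) (online_deps N f (set seen)))}"

definition instance_policies ::
  "'a aided_algorithm \<Rightarrow> 'a set \<Rightarrow> ('a set \<Rightarrow> bool) \<Rightarrow> ('a set \<Rightarrow> real) \<Rightarrow> real \<Rightarrow> 'a policy pmf" where
  "instance_policies A N indep f est = A (card N) (supermodular_degree N f) est indep"

definition expected_value ::
  "'a aided_algorithm \<Rightarrow> 'a set \<Rightarrow> ('a set \<Rightarrow> bool) \<Rightarrow> ('a set \<Rightarrow> real) \<Rightarrow> real \<Rightarrow> real" where
  "expected_value A N indep f est =
    measure_pmf.expectation
      (pair_pmf (pmf_of_set (permutations_of_set N)) (instance_policies A N indep f est))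
      (\<lambda>(\<sigma>, p). f (policy_output N f p \<sigma>))"

text \<open>The competitive ratio \<open>c\<close> is a function of the supermodular degree and the rank.\<close>

definition aided_competitive ::
  "real \<Rightarrow> 'a aided_algorithm \<Rightarrow> (nat \<Rightarrow> nat \<Rightarrow> real) \<Rightarrow> bool" where
  "aided_competitive \<alpha> A c \<longleftrightarrow>
    (\<forall>N indep f est. matroid_secretary_instance N indep f \<longrightarrow> is_estimation \<alpha> indep f est \<longrightarrow>
      (\<forall>\<sigma>\<in>permutations_of_set N. \<forall>p\<in>set_pmf (instance_policies A N indep f est).
         indep (policy_output N f p \<sigma>)) \<and>
      opt_value indep f
        \<le> c (supermodular_degree N f) (matroid_rank indep) * expected_value A N indep f est)"

text \<open>The bound \<open>d\<^sup>2 log (\<alpha> k)\<close>.  Taken literally it vanishes for submodular functions (\<open>d = 0\<close>)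
  and for \<open>\<alpha> k = 1\<close>, where no algorithm can have ratio \<open>0\<close>.  As usual in asymptotic bounds, a
  factor below \<open>1\<close> is read as \<open>1\<close>; for \<open>d \<ge> 1\<close> and \<open>\<alpha> k \<ge> 2\<close> nothing is changed.\<close>

definition ratio_bound :: "real \<Rightarrow> nat \<Rightarrow> nat \<Rightarrow> real" where
  "ratio_bound \<alpha> d k = (max 1 (real d))\<^sup>2 * max 1 (log 2 (\<alpha> * real k))"

end

theory Submission
  imports Defs
begin

text \<open>For a threshold \<open>\<tau>\<close>, keep a committed independent set \<open>S\<close>.  When \<open>u\<close> arrives, commit to
  \<open>u\<close> together with a set \<open>X\<close> of unrevealed supermodular dependencies of \<open>u\<close> whenever
  \<open>S \<union> X \<union> {u}\<close> is independent and \<open>f(u | S \<union> X) \<ge> \<tau>\<close>.  Each commitment adds at most \<open>d + 1\<close> elements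
  and gains at least \<open>\<tau>\<close>.

  Let \<open>w(u)\<close> be the marginal of \<open>u \<in> OPT\<close> with respect to the elements of \<open>OPT\<close> arriving after \<open>u\<close>,
  all of which are unrevealed when \<open>u\<close> arrives.  Choose \<open>Q' \<subseteq> OPT\<close> with \<open>S \<union> Q'\<close> independent and
  \<open>|OPT - Q'| \<le> |S|\<close>, and let \<open>A\<close> grow to \<open>Q'\<close> in reverse order of arrival.  The nonnegative quantity
  \<open>f(S \<union> A) - f(A)\<close> increases by at most \<open>\<tau>\<close> at each of the at most \<open>d |S|\<close> elements depending on \<open>S\<close>,
  does not increase at the others, and decreases by \<open>\<tau>\<close> at those with \<open>w(u) \<ge> 2 \<tau>\<close> independent of \<open>S\<close>
  and of \<open>OPT - Q'\<close>.  Hence \<open>\<tau> |{u. w(u) \<ge> 2 \<tau>}| = O(d\<^sup>2) (f(S) - f({}))\<close>, for every order of arrival.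
  A uniformly random choice among \<open>O(log (\<alpha> k))\<close> geometrically decreasing thresholds gives the ratio.\<close>

section \<open>Matroids and supermodular dependencies\<close>

context matroid
begin

lemma indep_finite: "indep X \<Longrightarrow> finite X"
  using finite_ground indep_subset finite_subset by blast

lemma card_le_rank:
  assumes "indep X"
  shows "card X \<le> matroid_rank indep"
proof -
  have "{X. indep X} \<subseteq> Pow N" using indep_subset by blast
  then have "finite {X. indep X}" using finite_ground by (simp add: finite_subset)
  then show ?thesis unfolding matroid_rank_def using assms by (intro Max_ge) auto
qed

text \<open>A largest independent set \<open>Z\<close> between \<open>S\<close> and
  \<open>S \<union> Q\<close> has at least \<open>card Q\<close> elements by augmentation, so
  \<open>Q - Z\<close> is no larger than \<open>Z - Q\<close>, which lies in
  \<open>S\<close>.\<close>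

lemma indep_exchange:
  assumes S: "indep S" and Q: "indep Q"
  obtains Q' where "Q' \<subseteq> Q" "indep (S \<union> Q')" "card (Q - Q') \<le> card S"
proof -
  define F where "F = {Z. S \<subseteq> Z \<and> Z \<subseteq> S \<union> Q \<and> indep Z}"
  have finSQ: "finite (S \<union> Q)" using S Q indep_finite by blast
  have "F \<subseteq> Pow (S \<union> Q)" by (auto simp: F_def)
  then have "finite F" using finSQ by (simp add: finite_subset)
  moreover have "S \<in> F" using S by (auto simp: F_def)
  ultimately obtain Z where Z: "Z \<in> F" and "Max (card ` F) = card Z"
    using obtains_MAX[of F card] by (metis empty_iff)
  then have max: "card Y \<le> card Z" if "Y \<in> F" for Y
    using that \<open>finite F\<close> by (metis Max_ge finite_imageI imageI)
  have iZ: "indep Z" and SZ: "S \<subseteq> Z" and ZSQ: "Z \<subseteq> S \<union> Q" using Z by (auto simp: F_def)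
  have finZ: "finite Z" using iZ indep_finite by blast
  have "card Q \<le> card Z"
  proof (rule ccontr)
    assume "\<not> card Q \<le> card Z"
    then obtain y where "y \<in> Q - Z" "indep (insert y Z)" using indep_augment[OF iZ Q] by auto
    then have "insert y Z \<in> F" using SZ ZSQ by (auto simp: F_def)
    from max[OF this] \<open>y \<in> Q - Z\<close> finZ show False by simp
  qed
  moreover have "card (Q - Z) = card Q - card (Q \<inter> Z)"
    using finSQ by (simp add: card_Diff_subset_Int)
  moreover have "card (Z - Q) = card Z - card (Q \<inter> Z)"
    using finZ by (simp add: card_Diff_subset_Int Int_commute)
  moreover have "card (Z - Q) \<le> card S"
    using ZSQ finSQ by (intro card_mono) auto
  moreover have "Q - Q \<inter> Z = Q - Z" by blast
  ultimately have "card (Q - Q \<inter> Z) \<le> card S" by simp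
  moreover have "indep (S \<union> Q \<inter> Z)" using SZ by (intro indep_hereditary[OF iZ]) auto
  ultimately show thesis using that[of "Q \<inter> Z"] by simp
qed

end

context matroid_secretary_instance
begin

abbreviation deps :: "'a \<Rightarrow> 'a set" where "deps \<equiv> supermodular_deps N f"
abbreviation sdeg :: nat where "sdeg \<equiv> supermodular_degree N f"

lemma deps_subset: "deps u \<subseteq> N"
  by (auto simp: supermodular_deps_def)

lemma finite_deps: "finite (deps u)"
  using deps_subset finite_ground finite_subset by blast

lemma card_deps_le: "u \<in> N \<Longrightarrow> card (deps u) \<le> sdeg"
  unfolding supermodular_degree_def using finite_ground by (intro Max_ge) auto

text \<open>Dependence means that the mixed second difference of \<open>f\<close> in
  \<open>u\<close> and \<open>v\<close> is positive at some \<open>S\<close>, which is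
  symmetric.\<close>

lemma deps_sym:
  assumes "u \<in> N" "v \<in> deps u"
  shows "u \<in> deps v"
proof -
  from assms(2) obtain S where v: "v \<in> N" and S: "S \<subseteq> N"
    and less: "marginal f u S < marginal f u (S \<union> {v})"
    by (auto simp: supermodular_deps_def)
  have "marginal f v S < marginal f v (S \<union> {u})"
    using less by (simp add: marginal_def insert_commute)
  then show ?thesis using assms(1) S by (auto simp: supermodular_deps_def)
qed

lemma card_dependent_le:
  assumes "Z \<subseteq> N"
  shows "card {u \<in> N. deps u \<inter> Z \<noteq> {}} \<le> sdeg * card Z"
proof -
  have finZ: "finite Z" using assms finite_ground finite_subset by blast
  have "{u \<in> N. deps u \<inter> Z \<noteq> {}} \<subseteq> (\<Union>z\<in>Z. deps z)" using deps_sym by blast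
  then have "card {u \<in> N. deps u \<inter> Z \<noteq> {}} \<le> card (\<Union>z\<in>Z. deps z)"
    using finZ finite_deps by (intro card_mono) auto
  also have "\<dots> \<le> (\<Sum>z\<in>Z. card (deps z))" using finZ by (rule card_UN_le)
  also have "\<dots> \<le> (\<Sum>z\<in>Z. sdeg)" using assms card_deps_le by (intro sum_mono) auto
  finally show ?thesis by (simp add: mult.commute)
qed

lemma marginal_nonneg:
  assumes "u \<in> N" "S \<subseteq> N"
  shows "0 \<le> marginal f u S"
  using monotone[of S "S \<union> {u}"] assms by (auto simp: marginal_def)

text \<open>Diminishing returns survive as long as no dependency of \<open>u\<close> is added: the
  new elements are inserted one at a time.\<close>

lemma marginal_antimono_off_deps:
  assumes "A \<subseteq> B" "B \<subseteq> N" "(B - A) \<inter> deps u = {}"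
  shows "marginal f u B \<le> marginal f u A"
proof -
  have "marginal f u (A \<union> Y) \<le> marginal f u A" if "finite Y" "A \<union> Y \<subseteq> N" "Y \<inter> deps u = {}" for Y
    using that
  proof (induction Y)
    case (insert y Y)
    then have "\<not> marginal f u (A \<union> Y) < marginal f u (A \<union> Y \<union> {y})"
      by (auto simp: supermodular_deps_def)
    then show ?case using insert by auto
  qed simp
  moreover have "finite (B - A)" using assms finite_ground finite_subset by blast
  moreover have "A \<union> (B - A) = B" using assms(1) by blast
  ultimately show ?thesis using assms by metis
qed

end

section \<open>The threshold policy\<close>

text \<open>\<open>R\<close> holds the arrivals before \<open>u\<close>; excluding them from
  \<open>X\<close> keeps earlier rejections irrevocable.\<close>

definition admissible_extension ::
  "real \<Rightarrow> ('a set \<Rightarrow> bool) \<Rightarrow> ('a \<Rightarrow> 'a set \<Rightarrow> real) \<Rightarrow> ('a \<Rightarrow> 'a set) \<Rightarrow>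
    'a set \<Rightarrow> 'a set \<Rightarrow> 'a \<Rightarrow> 'a set \<Rightarrow> bool" where
  "admissible_extension \<tau> indep g D R S u X \<longleftrightarrow>
    X \<subseteq> D u - R \<and> indep (insert u (S \<union> X)) \<and> \<tau> \<le> g u (S \<union> X)"

text \<open>The elements committed to so far, some of which may still have to arrive.  The list of
  revealed elements is in reverse order of arrival.\<close>

fun committed ::
  "real \<Rightarrow> ('a set \<Rightarrow> bool) \<Rightarrow> ('a \<Rightarrow> 'a set \<Rightarrow> real) \<Rightarrow> ('a \<Rightarrow> 'a set) \<Rightarrow> 'a list \<Rightarrow> 'a set" where
  "committed \<tau> indep g D [] = {}"
| "committed \<tau> indep g D (u # us) =
    (let S = committed \<tau> indep g D us; P = admissible_extension \<tau> indep g D (set us) S u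
     in if \<exists>X. P X then insert u (S \<union> (SOME X. P X)) else S)"

definition threshold_policy :: "real \<Rightarrow> ('a set \<Rightarrow> bool) \<Rightarrow> 'a policy" where
  "threshold_policy \<tau> indep xs g D \<longleftrightarrow> last xs \<in> committed \<tau> indep g D (rev xs)"

section \<open>Invariants of the committed set\<close>

context matroid_secretary_instance
begin

abbreviation ext :: "real \<Rightarrow> 'a list \<Rightarrow> 'a \<Rightarrow> 'a set \<Rightarrow> bool" where
  "ext \<tau> us u \<equiv> admissible_extension \<tau> indep (marginal f) deps (set us)
     (committed \<tau> indep (marginal f) deps us) u"

abbreviation comm :: "real \<Rightarrow> 'a list \<Rightarrow> 'a set" where
  "comm \<tau> us \<equiv> committed \<tau> indep (marginal f) deps us"

text \<open>The analysis works for any admissible \<open>X\<close>, so the choice made by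
  \<open>SOME\<close> is hidden here.\<close>

lemma comm_step:
  obtains (extend) X where "ext \<tau> us u X" "comm \<tau> (u # us) = insert u (comm \<tau> us \<union> X)"
  | (reject) "\<And>X. \<not> ext \<tau> us u X" "comm \<tau> (u # us) = comm \<tau> us"
proof (cases "\<exists>X. ext \<tau> us u X")
  case True
  then have "ext \<tau> us u (SOME X. ext \<tau> us u X)" by (rule someI_ex)
  then show thesis using True by (intro extend) (auto simp: Let_def)
next
  case False
  then show thesis by (intro reject) (auto simp: Let_def)
qed

text \<open>Processed elements are revealed and independence confines \<open>S \<union> X\<close> to
  \<open>N\<close>, so default oracle answers never affect admissibility; equal predicates make
  \<open>SOME\<close> choose equally.\<close>

lemma committed_online:
  assumes "set us \<subseteq> R"
  shows "committed \<tau> indep (online_marginal N f R) (online_deps N f R) us = comm \<tau> us"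
  using assms
proof (induction us)
  case (Cons u us)
  have "admissible_extension \<tau> indep (online_marginal N f R) (online_deps N f R) (set us) (comm \<tau> us) u
      = ext \<tau> us u"
    using Cons.prems indep_subset
    by (fastforce simp: admissible_extension_def online_marginal_def online_deps_def)
  then show ?case using Cons by simp
qed simp

lemma comm_indep: "indep (comm \<tau> us)"
proof (induction us)
  case (Cons u us)
  show ?case
    by (cases rule: comm_step[of \<tau> us u]) (use Cons in \<open>auto simp: admissible_extension_def\<close>)
qed (simp add: indep_empty)

lemma comm_subset: "comm \<tau> us \<subseteq> N"
  using comm_indep indep_subset by blast

lemma comm_mono: "comm \<tau> us \<subseteq> comm \<tau> (vs @ us)"
proof (induction vs)
  case (Cons v vs)
  show ?case
    by (cases rule: comm_step[of \<tau> "vs @ us" v]) (use Cons in auto)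
qed simp

text \<open>Extensions avoid revealed elements and each arrival is new, so a rejected element stays
  rejected.\<close>

lemma comm_no_late_commitment:
  assumes "distinct (vs @ us)"
  shows "comm \<tau> (vs @ us) \<inter> set us \<subseteq> comm \<tau> us"
  using assms
proof (induction vs)
  case (Cons v vs)
  show ?case
    by (cases rule: comm_step[of \<tau> "vs @ us" v])
      (use Cons in \<open>auto simp: admissible_extension_def\<close>)
qed simp

lemma comm_value:
  fixes \<tau> :: real
  assumes "0 \<le> \<tau>" "set us \<subseteq> N"
  shows "\<tau> * card (comm \<tau> us) \<le> (sdeg + 1) * (f (comm \<tau> us) - f {})"
  using assms(2)
proof (induction us)
  case (Cons u us)
  show ?case
  proof (cases rule: comm_step[of \<tau> us u])
    case (extend X)
    let ?S = "comm \<tau> us"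
    have X: "X \<subseteq> deps u" and ind: "indep (insert u (?S \<union> X))"
      and val: "\<tau> \<le> marginal f u (?S \<union> X)"
      using extend(1) by (auto simp: admissible_extension_def)
    have u: "u \<in> N" using Cons.prems by simp
    have "card X \<le> sdeg"
      using card_mono[OF finite_deps X] card_deps_le[OF u] by linarith
    moreover have "card (insert u (?S \<union> X)) \<le> card ?S + card X + 1"
      using card_Un_le[of ?S X] card_insert_le_m1[of "card ?S + card X + 1" "?S \<union> X" u] by simp
    ultimately have "card (insert u (?S \<union> X)) \<le> card ?S + (sdeg + 1)" by linarith
    then have "real (card (insert u (?S \<union> X))) \<le> real (card ?S + (sdeg + 1))"
      by (rule of_nat_mono)
    then have "\<tau> * card (insert u (?S \<union> X)) \<le> \<tau> * real (card ?S + (sdeg + 1))"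
      using assms(1) by (rule mult_left_mono)
    also have "\<dots> \<le> (sdeg + 1) * (f ?S - f {}) + (sdeg + 1) * \<tau>"
      using Cons by (simp add: algebra_simps)
    also have "\<dots> = (sdeg + 1) * (f ?S + \<tau> - f {})" by (simp add: algebra_simps)
    also have "\<dots> \<le> (sdeg + 1) * (f (insert u (?S \<union> X)) - f {})"
    proof (rule mult_left_mono)
      \<comment> \<open>By monotonicity \<open>X\<close> costs nothing, so the marginal of
        \<open>u\<close> alone secures the gain \<open>\<tau>\<close>.\<close>
      have "f ?S \<le> f (?S \<union> X)" using ind indep_subset by (intro monotone) blast+
      then show "f ?S + \<tau> - f {} \<le> f (insert u (?S \<union> X)) - f {}"
        using val by (simp add: marginal_def)
    qed simp
    finally show ?thesis using extend(2) by simp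
  next
    case reject
    then show ?thesis using Cons by simp
  qed
qed simp

text \<open>Commitments made after the arrival of \<open>u\<close> only concern elements unrevealed at that time,
  so those lying in \<open>deps u\<close> could have been committed to together with \<open>u\<close>.\<close>

lemma rejected_marginal:
  assumes "0 \<le> \<tau>" "distinct (vs @ u # us)" "A \<subseteq> set vs" "indep (comm \<tau> (vs @ u # us) \<union> insert u A)"
  shows "marginal f u (comm \<tau> (vs @ u # us) \<union> A) \<le> \<tau>"
proof (cases "u \<in> comm \<tau> (vs @ u # us)")
  case True
  then show ?thesis using assms(1) by (simp add: marginal_def insert_absorb)
next
  case False
  define S where "S = comm \<tau> (vs @ u # us)"
  define S0 where "S0 = comm \<tau> us"
  \<comment> \<open>\<open>X\<close> collects all of \<open>S \<union> A\<close> beyond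
    \<open>S0\<close> that can raise the marginal of \<open>u\<close>; what is left out can only
    lower it.\<close>
  define X where "X = deps u \<inter> (A \<union> (S - S0))"
  have ind: "indep (S \<union> insert u A)" using assms(4) by (simp only: S_def)
  have "u \<notin> comm \<tau> (u # us)" using False comm_mono by blast
  then have rej: "\<not> ext \<tau> us u X"
    by (cases rule: comm_step[of \<tau> us u]) auto
  have S0_le: "S0 \<subseteq> S" using comm_mono[of \<tau> us "vs @ [u]"] by (simp add: S_def S0_def)
  have disj: "S \<inter> set us \<subseteq> S0"
    using comm_no_late_commitment[of "vs @ [u]" us \<tau>] assms(2) by (simp add: S_def S0_def)
  have "X \<subseteq> deps u - set us" using disj assms(2,3) by (auto simp: X_def)
  moreover have "indep (insert u (S0 \<union> X))"
    using S0_le by (intro indep_hereditary[OF ind]) (auto simp: X_def)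
  ultimately have "marginal f u (S0 \<union> X) < \<tau>"
    using rej by (auto simp: admissible_extension_def S0_def)
  moreover have "marginal f u (S \<union> A) \<le> marginal f u (S0 \<union> X)"
  proof (rule marginal_antimono_off_deps)
    show "S0 \<union> X \<subseteq> S \<union> A" using S0_le by (auto simp: X_def)
    show "S \<union> A \<subseteq> N" using indep_subset[OF ind] by blast
  qed (auto simp: X_def)
  ultimately show ?thesis by (simp add: S_def)
qed

text \<open>A decision made on arrival agrees with the final committed set, since commitments are
  never revoked and never made late. Every element of \<open>N\<close> arrives, so each promised
  element is collected.\<close>

lemma policy_output_threshold:
  assumes "\<sigma> \<in> permutations_of_set N"
  shows "policy_output N f (threshold_policy \<tau> indep) \<sigma> = comm \<tau> (rev \<sigma>)"
proof -
  have set: "set \<sigma> = N" and dist: "distinct \<sigma>"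
    using assms by (auto simp: permutations_of_set_def)
  have dec: "(let seen = take (Suc i) \<sigma> in threshold_policy \<tau> indep seen
        (online_marginal N f (set seen)) (online_deps N f (set seen)))
      \<longleftrightarrow> \<sigma> ! i \<in> comm \<tau> (rev \<sigma>)" if i: "i < length \<sigma>" for i
  proof -
    let ?us = "rev (take (Suc i) \<sigma>)" and ?vs = "rev (drop (Suc i) \<sigma>)"
    have eq: "rev \<sigma> = ?vs @ ?us" by (simp flip: rev_append)
    have last: "last (take (Suc i) \<sigma>) = \<sigma> ! i" using i by (simp add: take_Suc_conv_app_nth)
    have "\<sigma> ! i \<in> set ?us" using i by (simp add: take_Suc_conv_app_nth)
    moreover have "distinct (?vs @ ?us)" using dist eq by (metis distinct_rev)
    ultimately have "\<sigma> ! i \<in> comm \<tau> ?us \<longleftrightarrow> \<sigma> ! i \<in> comm \<tau> (?vs @ ?us)"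
      using comm_mono[of \<tau> ?us ?vs] comm_no_late_commitment[of ?vs ?us \<tau>] by blast
    then show ?thesis using eq last
      by (simp add: Let_def threshold_policy_def committed_online)
  qed
  have "policy_output N f (threshold_policy \<tau> indep) \<sigma>
      = {\<sigma> ! i | i. i < length \<sigma> \<and> \<sigma> ! i \<in> comm \<tau> (rev \<sigma>)}"
    unfolding policy_output_def using dec by blast
  also have "\<dots> = set \<sigma> \<inter> comm \<tau> (rev \<sigma>)" by (auto simp: in_set_conv_nth)
  finally show ?thesis using set comm_subset by blast
qed

end

section \<open>Competitiveness for a single threshold\<close>

text \<open>Applied to the reversed arrival order \<open>rs\<close>, this is the set of elements
  arriving after \<open>x\<close>.\<close>

definition preceding :: "'a list \<Rightarrow> 'a \<Rightarrow> 'a set" where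
  "preceding xs x = set (takeWhile (\<lambda>y. y \<noteq> x) xs)"

lemma preceding_split:
  assumes "x \<in> set xs"
  obtains ys zs where "xs = ys @ x # zs" "preceding xs x = set ys"
proof -
  from assms obtain ys zs where "xs = ys @ x # zs" "x \<notin> set ys" by (meson split_list_first)
  moreover from this have "takeWhile (\<lambda>y. y \<noteq> x) xs = ys" by (auto simp: takeWhile_tail)
  ultimately show thesis using that by (simp add: preceding_def)
qed

lemma telescope_preceding:
  fixes F :: "'a set \<Rightarrow> real"
  assumes "distinct xs"
  shows "F (Q \<inter> set xs) - F {} =
    (\<Sum>x\<in>Q \<inter> set xs. F (insert x (Q \<inter> preceding xs x)) - F (Q \<inter> preceding xs x))"
  using assms
proof (induction xs rule: rev_induct)
  case (snoc y xs)
  have old: "preceding (xs @ [y]) x = preceding xs x" if "x \<in> set xs" for x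
    using that by (simp add: preceding_def)
  have new: "preceding (xs @ [y]) y = set xs"
    using snoc.prems by (subst preceding_def, subst takeWhile_append2) auto
  have "(\<Sum>x\<in>Q \<inter> set xs. F (insert x (Q \<inter> preceding (xs @ [y]) x)) - F (Q \<inter> preceding (xs @ [y]) x))
      = F (Q \<inter> set xs) - F {}"
    using snoc by (simp add: old)
  then show ?case using snoc.prems new by (cases "y \<in> Q") simp_all
qed simp

context matroid_secretary_instance
begin

abbreviation weight :: "'a list \<Rightarrow> 'a set \<Rightarrow> 'a \<Rightarrow> real" where
  "weight rs Q u \<equiv> marginal f u (Q \<inter> preceding rs u)"

text \<open>The factor \<open>2 * sdeg + 1\<close> adds \<open>sdeg * card S\<close> increases of
  \<open>h\<close> to \<open>(sdeg + 1) * card S\<close> heavy elements lost to \<open>Z\<close>;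
  \<open>comm_value\<close> then turns \<open>\<tau> * card S\<close> into value.\<close>

lemma threshold_competitive:
  fixes \<tau> :: real
  assumes \<tau>: "0 \<le> \<tau>" and rs: "distinct rs" "set rs = N" and Q: "indep Q"
  shows "\<tau> * card {u \<in> Q. 2 * \<tau> \<le> weight rs Q u}
    \<le> (1 + (2 * sdeg + 1) * (sdeg + 1)) * (f (comm \<tau> rs) - f {})"
proof -
  define S where "S = comm \<tau> rs"
  have iS: "indep S" and SN: "S \<subseteq> N" and finS: "finite S"
    using comm_indep comm_subset indep_finite by (auto simp: S_def)
  obtain Q' where Q': "Q' \<subseteq> Q" "indep (S \<union> Q')" "card (Q - Q') \<le> card S"
    using indep_exchange[OF iS Q] .
  have QN: "Q \<subseteq> N" using Q indep_subset by blast
  have finQ: "finite Q" using Q indep_finite by blast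
  define Z where "Z = Q - Q'"
  have ZN: "Z \<subseteq> N" using QN by (auto simp: Z_def)
  define H where "H = {u \<in> Q. 2 * \<tau> \<le> weight rs Q u}"
  define T where "T = {u \<in> Q'. 2 * \<tau> \<le> weight rs Q u \<and> deps u \<inter> Z = {}}"
  define B where "B = {u \<in> Q'. deps u \<inter> S \<noteq> {}}"
  have finQ': "finite Q'" using Q'(1) finQ finite_subset by blast
  define h where "h = (\<lambda>A. f (S \<union> A) - f A)"
  have step: "h (insert u (Q' \<inter> preceding rs u)) - h (Q' \<inter> preceding rs u)
      \<le> \<tau> * of_bool (u \<in> B) - \<tau> * of_bool (u \<in> T)" if u: "u \<in> Q'" for u
  proof -
    let ?A = "Q' \<inter> preceding rs u"
    have uN: "u \<in> N" using u Q'(1) QN by blast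
    obtain vs us where split: "rs = vs @ u # us" and pre: "preceding rs u = set vs"
      using preceding_split[of u rs] uN rs(2) by auto
    have pN: "preceding rs u \<subseteq> N" using pre split rs(2) by auto
    have eq: "h (insert u ?A) - h ?A = marginal f u (S \<union> ?A) - marginal f u ?A"
      by (simp add: h_def marginal_def)
    have "indep (S \<union> insert u ?A)"
      by (rule indep_hereditary[OF Q'(2)]) (use u in auto)
    then have le\<tau>: "marginal f u (S \<union> ?A) \<le> \<tau>"
      using rejected_marginal[of \<tau> vs u us ?A] \<tau> rs(1) split pre by (simp add: S_def)
    have nn: "0 \<le> marginal f u ?A" using uN pN by (intro marginal_nonneg) auto
    have nB: "marginal f u (S \<union> ?A) \<le> marginal f u ?A" if "u \<notin> B"
      by (rule marginal_antimono_off_deps) (use that u SN pN in \<open>auto simp: B_def\<close>)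
    have "2 * \<tau> \<le> marginal f u ?A" if "u \<in> T"
    proof -
      \<comment> \<open>Passing from \<open>Q\<close> to \<open>Q'\<close> removes only elements of
        \<open>Z\<close>, on which \<open>u\<close> does not depend.\<close>
      have "weight rs Q u \<le> marginal f u ?A"
        by (rule marginal_antimono_off_deps) (use that Q'(1) pN in \<open>auto simp: T_def Z_def\<close>)
      then show ?thesis using that by (simp add: T_def)
    qed
    then show ?thesis unfolding eq using le\<tau> nn nB \<tau> by (cases "u \<in> T"; cases "u \<in> B") auto
  qed
  have "Q' \<inter> set rs = Q'" using Q'(1) QN rs(2) by blast
  then have "h Q' - h {} = (\<Sum>u\<in>Q'. h (insert u (Q' \<inter> preceding rs u)) - h (Q' \<inter> preceding rs u))"
    using telescope_preceding[OF rs(1), of h Q'] by simp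
  also have "\<dots> \<le> (\<Sum>u\<in>Q'. \<tau> * of_bool (u \<in> B) - \<tau> * of_bool (u \<in> T))"
    using step by (rule sum_mono)
  also have "\<dots> = \<tau> * card B - \<tau> * card T"
  proof -
    have "Q' \<inter> B = B" "Q' \<inter> T = T" by (auto simp: B_def T_def)
    moreover have "(\<Sum>u\<in>Q'. of_bool (u \<in> Y) :: real) = card (Q' \<inter> Y)" for Y
      using finQ' by (simp add: of_bool_def sum.If_cases Int_def)
    ultimately show ?thesis by (simp add: sum_subtractf flip: sum_distrib_left)
  qed
  finally have "h Q' - h {} \<le> \<tau> * card B - \<tau> * card T" .
  \<comment> \<open>As \<open>h\<close> starts at \<open>f S - f {}\<close> and ends nonnegative,
    its total decrease is bounded.\<close>
  moreover have "0 \<le> h Q'"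
    using monotone[of Q' "S \<union> Q'"] Q'(1) QN SN by (auto simp: h_def)
  ultimately have T: "\<tau> * card T \<le> f S - f {} + \<tau> * card B" by (simp add: h_def)
  have cardB: "card B \<le> sdeg * card S"
  proof -
    have "card B \<le> card {u \<in> N. deps u \<inter> S \<noteq> {}}"
      using finite_ground Q'(1) QN by (intro card_mono) (auto simp: B_def)
    then show ?thesis using card_dependent_le[OF SN] by linarith
  qed
  have "card H \<le> card T + (sdeg + 1) * card S"
  proof -
    let ?Y = "{u \<in> N. deps u \<inter> Z \<noteq> {}}"
    \<comment> \<open>A heavy element outside \<open>T\<close> lies in \<open>Z\<close> or depends
      on \<open>Z\<close>.\<close>
    have "card H \<le> card (T \<union> (Z \<union> ?Y))"
      using finQ' finQ finite_ground QN by (intro card_mono) (auto simp: H_def T_def Z_def)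
    also have "\<dots> \<le> card T + (card Z + card ?Y)"
      by (meson add_left_mono card_Un_le le_trans)
    also have "\<dots> \<le> card T + (card S + sdeg * card S)"
      using card_dependent_le[OF ZN] Q'(3) mult_le_mono2[OF Q'(3), of sdeg]
      unfolding Z_def by linarith
    finally show ?thesis by simp
  qed
  then have "real (card H) \<le> real (card T + (sdeg + 1) * card S)"
    by (rule of_nat_mono)
  then have "\<tau> * card H \<le> \<tau> * real (card T + (sdeg + 1) * card S)"
    using \<tau> by (rule mult_left_mono)
  also have "\<dots> \<le> f S - f {} + \<tau> * card B + (real sdeg + 1) * (\<tau> * card S)"
    using T by (simp add: algebra_simps)
  also have "\<dots> \<le> f S - f {} + \<tau> * (sdeg * card S) + (real sdeg + 1) * (\<tau> * card S)"
    using mult_left_mono[OF of_nat_mono[OF cardB, where 'a=real] \<tau>] by simp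
  also have "\<dots> = f S - f {} + (2 * real sdeg + 1) * (\<tau> * card S)"
    by (simp add: algebra_simps)
  also have "\<dots> \<le> f S - f {} + (2 * real sdeg + 1) * ((sdeg + 1) * (f S - f {}))"
    using comm_value[OF \<tau>, of rs] rs(2) by (intro add_left_mono mult_left_mono) (auto simp: S_def)
  also have "\<dots> = (1 + (2 * sdeg + 1) * (sdeg + 1)) * (f S - f {})"
    by (simp add: algebra_simps)
  finally show ?thesis by (simp add: H_def S_def)
qed

end

section \<open>A random threshold\<close>

text \<open>A value at most \<open>M\<close> is either at most \<open>M / 2 ^ L\<close> or at most
  twice some threshold that it reaches.\<close>

lemma sum_le_geometric_thresholds:
  fixes w :: "'a \<Rightarrow> real"
  assumes "finite Q" "0 \<le> M" "\<And>u. u \<in> Q \<Longrightarrow> w u \<le> M"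
  shows "sum w Q \<le> card Q * (M / 2 ^ L) + 2 * (\<Sum>i\<le>L. M / 2 ^ i * card {u \<in> Q. M / 2 ^ i \<le> w u})"
proof -
  define B where "B = (\<lambda>L u. 2 * (\<Sum>i\<le>L. M / 2 ^ i * of_bool (M / 2 ^ i \<le> w u)))"
  have B_nonneg: "0 \<le> B L u" for L u
    unfolding B_def using assms(2) by (intro mult_nonneg_nonneg sum_nonneg) auto
  have "w u \<le> M / 2 ^ L \<or> w u \<le> B L u" if u: "u \<in> Q" for u
  proof (induction L)
    case (Suc L)
    \<comment> \<open>The factor 2 in \<open>B\<close> turns the new threshold into the previous
      one, \<open>M / 2 ^ L\<close>.\<close>
    have BS: "B (Suc L) u = B L u + M / 2 ^ L * of_bool (M / 2 ^ Suc L \<le> w u)"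
      by (simp add: B_def)
    show ?case
    proof (cases "M / 2 ^ Suc L \<le> w u")
      case True
      then have "B (Suc L) u = B L u + M / 2 ^ L" using BS by simp
      moreover have "0 \<le> M / 2 ^ L" using assms(2) by simp
      ultimately show ?thesis using Suc B_nonneg[of L u] by linarith
    qed simp
  qed (use assms(3) u in simp)
  then have "w u \<le> M / 2 ^ L + B L u" if "u \<in> Q" for u
    using that B_nonneg[of L u] assms(2) by (smt (verit) divide_nonneg_nonneg zero_le_power)
  then have "sum w Q \<le> (\<Sum>u\<in>Q. M / 2 ^ L + B L u)" by (rule sum_mono)
  also have "\<dots> = card Q * (M / 2 ^ L) + (\<Sum>u\<in>Q. B L u)" by (simp add: sum.distrib)
  also have "(\<Sum>u\<in>Q. B L u) = 2 * (\<Sum>i\<le>L. \<Sum>u\<in>Q. M / 2 ^ i * of_bool (M / 2 ^ i \<le> w u))"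
    unfolding B_def by (simp add: sum.swap[of _ Q] flip: sum_distrib_left)
  also have "\<dots> = 2 * (\<Sum>i\<le>L. M / 2 ^ i * card {u \<in> Q. M / 2 ^ i \<le> w u})"
  proof -
    have "(\<Sum>u\<in>Q. of_bool (M / 2 ^ i \<le> w u) :: real) = card {u \<in> Q. M / 2 ^ i \<le> w u}" for i
      using assms(1) by (simp add: of_bool_def sum.If_cases Int_def)
    then show ?thesis by (simp only: flip: sum_distrib_left)
  qed
  finally show ?thesis .
qed

text \<open>This is the last index, so there is one threshold more. The \<open>+ 1\<close> makes the
  truncated tail at most half the optimum.\<close>

definition num_thresholds :: "real \<Rightarrow> ('a set \<Rightarrow> bool) \<Rightarrow> nat" where
  "num_thresholds \<alpha> indep = nat \<lceil>log 2 (\<alpha> * matroid_rank indep)\<rceil> + 1"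

text \<open>\<open>\<alpha> * est\<close> lies between the optimum and \<open>\<alpha>\<close> times
  it. The exponent \<open>Suc i\<close> halves level \<open>i\<close>, because a threshold
  \<open>\<tau>\<close> handles weights of at least \<open>2 * \<tau>\<close>.\<close>

definition random_threshold_algorithm :: "real \<Rightarrow> 'a aided_algorithm" where
  "random_threshold_algorithm \<alpha> n d est indep =
    map_pmf (\<lambda>i. threshold_policy (\<alpha> * est / 2 ^ Suc i) indep)
      (pmf_of_set {..num_thresholds \<alpha> indep})"

lemma num_thresholds_lower:
  fixes \<alpha> :: real
  assumes "1 \<le> \<alpha>"
  shows "2 * (\<alpha> * matroid_rank indep) \<le> 2 ^ num_thresholds \<alpha> indep"
proof (cases "matroid_rank indep = 0")
  case False
  let ?x = "\<alpha> * matroid_rank indep"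
  have "0 < ?x" using assms False by simp
  then have "?x = 2 powr log 2 ?x" by simp
  also have "\<dots> \<le> 2 powr real (nat \<lceil>log 2 ?x\<rceil>)"
    by (intro powr_mono) (auto intro: real_nat_ceiling_ge)
  finally show ?thesis by (simp add: num_thresholds_def powr_realpow)
qed simp

text \<open>For a logarithm \<open>x \<ge> 1\<close> the count is at most
  \<open>x + 3 \<le> 4 * x\<close>; for smaller \<open>x\<close> it is at most 3.\<close>

lemma num_thresholds_upper:
  "real (num_thresholds \<alpha> indep + 1) \<le> 4 * max 1 (log 2 (\<alpha> * matroid_rank indep))"
  unfolding num_thresholds_def by linarith

context matroid_secretary_instance
begin

text \<open>This holds for every arrival order. The 8 is a product of three 2s: the tail of half the
  optimum, the dyadic rounding, and the halved thresholds.\<close>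

lemma thresholds_sum_competitive:
  assumes \<alpha>: "1 \<le> \<alpha>" and est: "is_estimation \<alpha> indep f est"
    and rs: "distinct rs" "set rs = N"
  shows "opt_value indep f \<le> 8 * (1 + (2 * sdeg + 1) * (sdeg + 1)) *
    (\<Sum>i\<le>num_thresholds \<alpha> indep. f (comm (\<alpha> * est / 2 ^ Suc i) rs))"
proof -
  define opt where "opt = opt_value indep f"
  define L where "L = num_thresholds \<alpha> indep"
  define M where "M = \<alpha> * est"
  define K :: real where "K = 1 + (2 * sdeg + 1) * (sdeg + 1)"
  define S where "S = (\<lambda>i. comm (M / 2 ^ Suc i) rs)"
  have "{X. indep X} \<subseteq> Pow N" using indep_subset by blast
  then have "finite {X. indep X}" using finite_ground by (simp add: finite_subset)
  moreover have "{X. indep X} \<noteq> {}" using indep_empty by blast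
  ultimately have "opt \<in> f ` {X. indep X}" unfolding opt_def opt_value_def by (intro Max_in) auto
  then obtain Q where Q: "indep Q" and fQ: "f Q = opt" by auto
  have QN: "Q \<subseteq> N" and finQ: "finite Q" using Q indep_subset indep_finite by auto
  have opt0: "0 \<le> opt" using nonneg QN fQ by metis
  have optM: "opt \<le> M" and Mopt: "M \<le> \<alpha> * opt"
    using est \<alpha> by (simp_all add: is_estimation_def M_def opt_def field_simps)
  have M0: "0 \<le> M" using opt0 optM by simp
  let ?w = "weight rs Q"
  have pN: "preceding rs u \<subseteq> N" for u
    using set_takeWhileD rs(2) by (fastforce simp: preceding_def)
  have wM: "?w u \<le> M" if u: "u \<in> Q" for u
  proof -
    have "f (insert u (Q \<inter> preceding rs u)) \<le> f Q" using u QN by (intro monotone) auto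
    moreover have "0 \<le> f (Q \<inter> preceding rs u)" using QN by (intro nonneg) auto
    ultimately show ?thesis using fQ optM by (simp add: marginal_def)
  qed
  have "Q \<inter> set rs = Q" using QN rs(2) by blast
  then have wsum: "opt - f {} = sum ?w Q"
    using telescope_preceding[OF rs(1), of f Q] fQ by (simp add: marginal_def)
  have "card Q * (M / 2 ^ L) \<le> opt / 2"
  proof -
    have "card Q * M \<le> matroid_rank indep * (\<alpha> * opt)"
      using card_le_rank[OF Q] Mopt M0 by (intro mult_mono) auto
    also have "\<dots> = (\<alpha> * matroid_rank indep) * opt" by simp
    also have "\<dots> \<le> 2 ^ L / 2 * opt"
      using num_thresholds_lower[OF \<alpha>, of indep] opt0
      by (intro mult_right_mono) (simp_all add: L_def)
    finally show ?thesis by (simp add: field_simps)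
  qed
  moreover have "sum ?w Q \<le> card Q * (M / 2 ^ L)
      + 2 * (\<Sum>i\<le>L. M / 2 ^ i * card {u \<in> Q. M / 2 ^ i \<le> ?w u})"
    using finQ M0 wM by (rule sum_le_geometric_thresholds)
  ultimately have "opt / 2 - f {} \<le> 2 * (\<Sum>i\<le>L. M / 2 ^ i * card {u \<in> Q. M / 2 ^ i \<le> ?w u})"
    using wsum by linarith
  also have "\<dots> \<le> 2 * (\<Sum>i\<le>L. 2 * (K * (f (S i) - f {})))"
  proof (intro mult_left_mono sum_mono)
    fix i
    have "2 * (M / 2 ^ Suc i) = M / 2 ^ i" by simp
    then have "M / 2 ^ Suc i * card {u \<in> Q. M / 2 ^ i \<le> ?w u} \<le> K * (f (S i) - f {})"
      using threshold_competitive[OF _ rs Q, of "M / 2 ^ Suc i"] M0 by (simp add: K_def S_def)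
    then show "M / 2 ^ i * card {u \<in> Q. M / 2 ^ i \<le> ?w u} \<le> 2 * (K * (f (S i) - f {}))"
      by simp
  qed simp
  also have "\<dots> = 4 * K * (\<Sum>i\<le>L. f (S i)) - 4 * (K * (real L + 1)) * f {}"
    by (simp add: sum_subtractf algebra_simps flip: sum_distrib_left)
  finally have "opt / 2 - f {} + 4 * (K * (real L + 1)) * f {} \<le> 4 * K * (\<Sum>i\<le>L. f (S i))"
    by linarith
  \<comment> \<open>\<open>f {}\<close> may be positive; the copies subtracted by the thresholds
    outweigh the one in the telescoped sum.\<close>
  moreover have "1 * f {} \<le> 4 * (K * (real L + 1)) * f {}"
  proof (rule mult_right_mono)
    have "1 * 1 \<le> K * (real L + 1)" unfolding K_def by (intro mult_mono) auto
    then show "1 \<le> 4 * (K * (real L + 1))" by simp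
  qed (simp add: nonneg)
  ultimately have "opt \<le> 8 * K * (\<Sum>i\<le>L. f (S i))" by linarith
  then show ?thesis by (simp add: opt_def K_def S_def L_def M_def)
qed

section \<open>Averaging over arrival orders and thresholds\<close>

lemma random_threshold_expected_value:
  "expected_value (random_threshold_algorithm \<alpha>) N indep f est =
    (\<Sum>\<sigma>\<in>permutations_of_set N. \<Sum>i\<le>num_thresholds \<alpha> indep.
        f (comm (\<alpha> * est / 2 ^ Suc i) (rev \<sigma>)))
      / (card (permutations_of_set N) * real (num_thresholds \<alpha> indep + 1))"
proof -
  let ?P = "permutations_of_set N" and ?I = "{..num_thresholds \<alpha> indep}"
  let ?p = "\<lambda>i. threshold_policy (\<alpha> * est / 2 ^ Suc i) indep"
  have fin: "finite ?P" "?P \<noteq> {}" using finite_ground by auto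
  have "pair_pmf (pmf_of_set ?P) (pmf_of_set ?I) = pmf_of_set (?P \<times> ?I)"
    using fin by (intro pmf_eqI) (auto simp: pmf_pair indicator_def algebra_simps)
  then have "expected_value (random_threshold_algorithm \<alpha>) N indep f est
      = measure_pmf.expectation (pmf_of_set (?P \<times> ?I)) (\<lambda>(\<sigma>, i). f (policy_output N f (?p i) \<sigma>))"
    by (simp add: expected_value_def instance_policies_def random_threshold_algorithm_def
        pair_map_pmf2 case_prod_unfold)
  also have "\<dots> = (\<Sum>(\<sigma>, i)\<in>?P \<times> ?I. f (policy_output N f (?p i) \<sigma>)) / card (?P \<times> ?I)"
    using fin by (subst integral_pmf_of_set) auto
  also have "(\<Sum>(\<sigma>, i)\<in>?P \<times> ?I. f (policy_output N f (?p i) \<sigma>))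
      = (\<Sum>\<sigma>\<in>?P. \<Sum>i\<in>?I. f (comm (\<alpha> * est / 2 ^ Suc i) (rev \<sigma>)))"
    by (simp add: policy_output_threshold flip: sum.cartesian_product)
  finally show ?thesis by (simp only: card_cartesian_product card_atMost of_nat_mult Suc_eq_plus1)
qed

text \<open>Here 224 is 8 * 7 * 4: the 8 of \<open>thresholds_sum_competitive\<close>,
  \<open>K\<close> being at most 7 times the squared degree factor, and the 4 of
  \<open>num_thresholds_upper\<close>.\<close>

lemma random_threshold_competitive:
  assumes \<alpha>: "1 \<le> \<alpha>" and est: "is_estimation \<alpha> indep f est"
  shows "opt_value indep f \<le> 224 * ratio_bound \<alpha> sdeg (matroid_rank indep)
    * expected_value (random_threshold_algorithm \<alpha>) N indep f est"
proof -
  define P where "P = permutations_of_set N"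
  define m :: real where "m = real (num_thresholds \<alpha> indep + 1)"
  define K :: real where "K = 1 + (2 * sdeg + 1) * (sdeg + 1)"
  define V where "V = (\<lambda>\<sigma>. \<Sum>i\<le>num_thresholds \<alpha> indep. f (comm (\<alpha> * est / 2 ^ Suc i) (rev \<sigma>)))"
  define E where "E = expected_value (random_threshold_algorithm \<alpha>) N indep f est"
  have P: "0 < real (card P)"
    using finite_ground by (simp add: P_def card_gt_0_iff)
  have m: "0 < m" by (simp add: m_def)
  have E: "E = sum V P / (card P * m)"
    unfolding E_def V_def P_def m_def by (rule random_threshold_expected_value)
  have "0 \<le> V \<sigma>" for \<sigma> unfolding V_def using comm_subset nonneg by (intro sum_nonneg) auto
  then have E0: "0 \<le> E" using m P E by (simp add: sum_nonneg)
  have "(\<Sum>\<sigma>\<in>P. opt_value indep f) \<le> (\<Sum>\<sigma>\<in>P. 8 * K * V \<sigma>)"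
  proof (rule sum_mono)
    fix \<sigma> assume "\<sigma> \<in> P"
    then have "distinct (rev \<sigma>)" "set (rev \<sigma>) = N"
      by (auto simp: P_def permutations_of_set_def)
    from thresholds_sum_competitive[OF \<alpha> est this]
    show "opt_value indep f \<le> 8 * K * V \<sigma>" by (simp add: K_def V_def)
  qed
  then have "card P * opt_value indep f \<le> 8 * K * sum V P" by (simp add: sum_distrib_left)
  also have "\<dots> = card P * (8 * K * (m * E))" using P m by (simp add: E)
  finally have "opt_value indep f \<le> 8 * K * (m * E)" using P by simp
  also have "\<dots> \<le> 8 * (7 * (max 1 (real sdeg))\<^sup>2)
      * (4 * max 1 (log 2 (\<alpha> * matroid_rank indep)) * E)"
  proof (intro mult_mono mult_right_mono mult_left_mono mult_nonneg_nonneg)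
    define D where "D = max 1 (real sdeg)"
    have "K = 2 * (real sdeg)\<^sup>2 + 3 * sdeg + 2"
      by (simp add: K_def algebra_simps power2_eq_square)
    also have "\<dots> \<le> 2 * D\<^sup>2 + 3 * D + 2"
      by (intro add_mono mult_left_mono power_mono) (auto simp: D_def)
    also have "\<dots> \<le> 7 * D\<^sup>2"
    proof -
      have "1 \<le> D" by (simp add: D_def)
      then have "D \<le> D\<^sup>2" by (simp add: power2_eq_square)
      with \<open>1 \<le> D\<close> show ?thesis by linarith
    qed
    finally show "K \<le> 7 * (max 1 (real sdeg))\<^sup>2" by (simp add: D_def)
  qed (use num_thresholds_upper[of \<alpha> indep] E0 m in \<open>auto simp: m_def K_def\<close>)
  finally show ?thesis by (simp add: ratio_bound_def E_def mult_ac)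
qed

end

theorem theorem4:
  "\<exists>C>0. \<forall>\<alpha>\<ge>1. \<exists>A :: 'a aided_algorithm.
     aided_competitive \<alpha> A (\<lambda>d k. C * ratio_bound \<alpha> d k)"
proof (intro exI[of _ 224] conjI allI impI)
  fix \<alpha> :: real
  assume \<alpha>: "1 \<le> \<alpha>"
  have "aided_competitive \<alpha> (random_threshold_algorithm \<alpha> :: 'a aided_algorithm)
    (\<lambda>d k. 224 * ratio_bound \<alpha> d k)"
    unfolding aided_competitive_def
  proof (intro allI impI conjI ballI)
    fix N :: "'a set" and indep f est
    assume inst: "matroid_secretary_instance N indep f" and est: "is_estimation \<alpha> indep f est"
    interpret matroid_secretary_instance N indep f by (rule inst)
    show "opt_value indep f \<le> 224 * ratio_bound \<alpha> (supermodular_degree N f) (matroid_rank indep)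
        * expected_value (random_threshold_algorithm \<alpha>) N indep f est"
      using \<alpha> est by (rule random_threshold_competitive)
    fix \<sigma> p
    assume "\<sigma> \<in> permutations_of_set N"
      and "p \<in> set_pmf (instance_policies (random_threshold_algorithm \<alpha>) N indep f est)"
    then show "indep (policy_output N f p \<sigma>)"
      by (auto simp: instance_policies_def random_threshold_algorithm_def policy_output_threshold
          comm_indep)
  qed
  then show "\<exists>A :: 'a aided_algorithm. aided_competitive \<alpha> A (\<lambda>d k. 224 * ratio_bound \<alpha> d k)"
    by blast
qed simp

end
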